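(* Let $\eta$ be a sublinear measure of non-compactness defined on a dual Banach space $X^*$. Assume that there exists a constant $\theta>0$ such that for every convex weak$^*$-compact subset $A$ of $X^*$ and every $\varepsilon>0$, $[\eta]^\omega_\varepsilon(A)=\emptyset$ implies $\langle\eta\rangle^\omega_{\theta\varepsilon}(A)=\emptyset$. Then for every convex weak$^*$-compact subset $A$ of $X^*$, every $\varepsilon>0$, every $\lambda>\theta$ and every ordinal $\alpha$, $$\langle\eta\rangle^{\omega\cdot\alpha}_{\lambda\varepsilon}(A)\subset\langle\eta^\omega\rangle^\alpha_\varepsilon(A).$$
   Context: A measure of non-compactness on $X^*$ is a map $\eta$ from the weak$^*$-compact subsets of $X^*$ to $[0,\infty)$ such that: (i) $\eta(\{x^*\})=0$ for all $x^*\in X^*$; (ii) $\eta(\bigcup_{i=1}^nA_i)=\max_i\eta(A_i)$ for weak$^*$-compact $A_1,\dots,A_n$; (iii) there is $b>0$ with $\eta(A+\lambda B_{X^*})\le\eta(A)+\lambda b$ for all weak$^*$-compact $A$ and $\lambda>0$ ($B_{X^*}$ the closed unit ball of $X^*$). It is sublinear if it is homogeneous ($\eta(\lambda A)=|\lambda|\eta(A)$ for all $\lambda\in\mathbb R$) and subadditive ($\eta(A+B)\le\eta(A)+\eta(B)$) on weak$^*$-compact sets. Write $\overline{E}^*$ for the weak$^*$-closure. Fragment derivation: $[\eta]'_\varepsilon(A)=\{x^*\in A:\ \eta(A\cap\overline{U}^* )\ge\varepsilon$ for every weak$^*$-neighborhood $U$ of $x^*\}$. Slice derivation: $\langle\eta\rangle'_\varepsilon(A)=\{x^*\in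 A:\ \eta(A\cap\overline{H}^* )\ge\varepsilon$ for every weak$^*$-open halfspace $H$ containing $x^*\}$. Both are iterated transfinitely: $[\eta]^0_\varepsilon(A)=A$, $[\eta]^{\gamma+1}_\varepsilon(A)=[\eta]'_\varepsilon([\eta]^\gamma_\varepsilon(A))$, $[\eta]^\gamma_\varepsilon(A)=\bigcap_{\beta<\gamma}[\eta]^\beta_\varepsilon(A)$ for limit $\gamma$, and similarly for $\langle\eta\rangle^\gamma_\varepsilon(A)$. The $\omega$-iterated measure is $\eta^\omega(A)=\inf\{\varepsilon>0:\ [\eta]^\omega_\varepsilon(A)=\emptyset\}$; it is again a measure of non-compactness. *)

theory Defs
  imports "HOL-Analysis.Analysis"
begin

section \<open>The weak* topology on a dual space\<close>

text \<open>The dual of \<open>'a\<close> is \<open>'a \<Rightarrow>\<^sub>L real\<close> with the operator norm. On functionals the library's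
  strong operator topology is the topology of pointwise convergence, i.e. the weak* topology.\<close>

abbreviation weak_star :: "('a::real_normed_vector \<Rightarrow>\<^sub>L real) topology" where
  "weak_star \<equiv> strong_operator_topology"

definition weak_star_nhd :: "('a::real_normed_vector \<Rightarrow>\<^sub>L real) set \<Rightarrow> ('a \<Rightarrow>\<^sub>L real) \<Rightarrow> bool" where
  "weak_star_nhd U f \<longleftrightarrow> (\<exists>V. openin weak_star V \<and> f \<in> V \<and> V \<subseteq> U)"

definition weak_star_open_halfspace :: "('a::real_normed_vector \<Rightarrow>\<^sub>L real) set \<Rightarrow> bool" where
  "weak_star_open_halfspace H \<longleftrightarrow> (\<exists>x t. x \<noteq> 0 \<and> H = {f. blinfun_apply f x > t})"


section \<open>Measures of non-compactness\<close>

text \<open>A measure is a total function on sets; only its values on weak*-compact sets are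
  constrained (and matter below). Addition of sets is the Minkowski sum from
  \<open>HOL-Library.Set_Algebras\<close>.\<close>

definition noncompactness_measure ::
    "(('a::real_normed_vector \<Rightarrow>\<^sub>L real) set \<Rightarrow> real) \<Rightarrow> bool" where
  "noncompactness_measure \<eta> \<longleftrightarrow>
     (\<forall>A. compactin weak_star A \<longrightarrow> 0 \<le> \<eta> A) \<and>
     (\<forall>f. \<eta> {f} = 0) \<and>
     (\<forall>n (A :: nat \<Rightarrow> _). 1 \<le> n \<and> (\<forall>i\<in>{1..n}. compactin weak_star (A i)) \<longrightarrow>
        \<eta> (\<Union>i\<in>{1..n}. A i) = Max ((\<lambda>i. \<eta> (A i)) ` {1..n})) \<and>
     (\<exists>b>0. \<forall>A c. compactin weak_star A \<and> 0 < c \<longrightarrow>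
        \<eta> (A + (\<lambda>f. c *\<^sub>R f) ` cball 0 1) \<le> \<eta> A + c * b)"

definition sublinear_measure ::
    "(('a::real_normed_vector \<Rightarrow>\<^sub>L real) set \<Rightarrow> real) \<Rightarrow> bool" where
  "sublinear_measure \<eta> \<longleftrightarrow>
     (\<forall>A c. compactin weak_star A \<longrightarrow> \<eta> ((\<lambda>f. c *\<^sub>R f) ` A) = \<bar>c\<bar> * \<eta> A) \<and>
     (\<forall>A B. compactin weak_star A \<and> compactin weak_star B \<longrightarrow> \<eta> (A + B) \<le> \<eta> A + \<eta> B)"

definition fragment_deriv ::
    "(('a::real_normed_vector \<Rightarrow>\<^sub>L real) set \<Rightarrow> real) \<Rightarrow> real \<Rightarrow>
      ('a \<Rightarrow>\<^sub>L real) set \<Rightarrow> ('a \<Rightarrow>\<^sub>L real) set" where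
  "fragment_deriv \<eta> \<epsilon> A =
     {f \<in> A. \<forall>U. weak_star_nhd U f \<longrightarrow> \<eta> (A \<inter> (weak_star closure_of U)) \<ge> \<epsilon>}"

definition slice_deriv ::
    "(('a::real_normed_vector \<Rightarrow>\<^sub>L real) set \<Rightarrow> real) \<Rightarrow> real \<Rightarrow>
      ('a \<Rightarrow>\<^sub>L real) set \<Rightarrow> ('a \<Rightarrow>\<^sub>L real) set" where
  "slice_deriv \<eta> \<epsilon> A =
     {f \<in> A. \<forall>H. weak_star_open_halfspace H \<and> f \<in> H \<longrightarrow>
        \<eta> (A \<inter> (weak_star closure_of H)) \<ge> \<epsilon>}"


section \<open>Ordinals and transfinite iteration\<close>

text \<open>An ordinal is represented by a well-order relation of that order type, as in the library's
  theory of well-orders; \<open>natLeq\<close> represents \<open>\<omega>\<close>. The ordinals below the order type of \<open>r\<close> are the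
  order types of the proper initial segments \<open>underS r x\<close> for \<open>x \<in> Field r\<close>.\<close>

text \<open>The ordinal product (\<open>s\<close> many copies of \<open>r\<close>, so the second component is the most
  significant one), defined as in \<open>HOL-Cardinals.Ordinal_Arithmetic\<close>.\<close>

definition ord_prod :: "'i rel \<Rightarrow> 'j rel \<Rightarrow> ('i \<times> 'j) rel" where
  "ord_prod r s = {((x, y), (x', y')).
     x \<in> Field r \<and> x' \<in> Field r \<and> y \<in> Field s \<and> y' \<in> Field s \<and>
     (y \<noteq> y' \<and> (y, y') \<in> s \<or> y = y' \<and> (x, x') \<in> r)}"

text \<open>\<open>iter_stage r D A F S\<close> is the iterate of \<open>D\<close> on \<open>A\<close> whose index is the order type of the
  initial segment \<open>S\<close> of \<open>r\<close>, where \<open>F x\<close>, for \<open>x \<in> S\<close>, is the iterate whose index is the order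
  type of \<open>underS r x\<close>. The index is zero iff \<open>S\<close> is empty, and it is the successor of the order
  type of \<open>underS r m\<close> iff \<open>m\<close> is the greatest element of \<open>S\<close>.\<close>

definition iter_stage ::
    "'i rel \<Rightarrow> ('b set \<Rightarrow> 'b set) \<Rightarrow> 'b set \<Rightarrow> ('i \<Rightarrow> 'b set) \<Rightarrow> 'i set \<Rightarrow> 'b set" where
  "iter_stage r D A F S =
     (if S = {} then A
      else if \<exists>m\<in>S. \<forall>x\<in>S. (x, m) \<in> r
        then D (F (THE m. m \<in> S \<and> (\<forall>x\<in>S. (x, m) \<in> r)))
      else (\<Inter>x\<in>S. F x))"

definition ord_iter :: "'i rel \<Rightarrow> ('b set \<Rightarrow> 'b set) \<Rightarrow> 'b set \<Rightarrow> 'b set" where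
  "ord_iter r D A =
     iter_stage r D A (wo_rel.worec r (\<lambda>F x. iter_stage r D A F (underS r x))) (Field r)"

definition omega_measure ::
    "(('a::real_normed_vector \<Rightarrow>\<^sub>L real) set \<Rightarrow> real) \<Rightarrow> ('a \<Rightarrow>\<^sub>L real) set \<Rightarrow> real" where
  "omega_measure \<eta> A = Inf {\<epsilon>. 0 < \<epsilon> \<and> ord_iter natLeq (fragment_deriv \<eta> \<epsilon>) A = {}}"

end

theory Submission
  imports Defs
begin

text \<open>The heart of the matter is the case \<open>\<alpha> = 1\<close>: if \<open>f\<close> lies in an open halfspace \<open>{x > t}\<close> with
  \<open>\<eta>\<^sup>\<omega>(B \<inter> {x \<ge> t}) < \<epsilon>\<close>, then finitely many slice derivations with a parameter below \<open>\<mu> \<epsilon>\<close>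
  exhaust the cap \<open>B \<inter> {x \<ge> t}\<close>, and one must see that \<open>f\<close> leaves \<open>B\<close> itself in finitely many
  derivations. If \<open>x \<le> M\<close> on \<open>B\<close>, the \<open>k\<close>-th derived set of \<open>B\<close> is contained in the convex hull of
  the \<open>k\<close>-th derived cap and of \<open>B \<inter> {x \<le> M - r\<^sup>k (M - t)}\<close>, where \<open>r\<close> is small: a slice
  missing the next hull is, up to an error in \<open>r (B - B)\<close>, a slice of the derived cap missing its
  derivation, and the latter has small measure by compactness. So \<open>n\<close> derivations shrink \<open>M - t\<close> by
  the factor \<open>1 - r\<^sup>n\<close>, and repetition brings \<open>M\<close> below \<open>f(x)\<close>. The general case follows by
  transfinite induction, using monotonicity of the slice derivation.\<close>

section \<open>Transfinite iteration\<close>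

lemma iter_stage_greatest:
  assumes "antisym r" "m \<in> S" "\<And>x. x \<in> S \<Longrightarrow> (x, m) \<in> r"
  shows "iter_stage r D A F S = D (F m)"
proof -
  have "(THE m. m \<in> S \<and> (\<forall>x\<in>S. (x, m) \<in> r)) = m"
    using assms by (intro the_equality) (auto dest: antisymD)
  then show ?thesis using assms(2,3) by (auto simp: iter_stage_def)
qed

lemma iter_stage_limit:
  assumes "S \<noteq> {}" "\<not> (\<exists>m\<in>S. \<forall>x\<in>S. (x, m) \<in> r)"
  shows "iter_stage r D A F S = (\<Inter>x\<in>S. F x)"
  unfolding iter_stage_def using assms by (simp only: if_False)

text \<open>A stage reads \<open>F\<close> only on \<open>S\<close>; for
  \<open>S = underS r x\<close> this is the admissibility condition of well-founded
  recursion.\<close>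

lemma iter_stage_cong:
  assumes "antisym r" "\<And>x. x \<in> S \<Longrightarrow> F x = G x"
  shows "iter_stage r D A F S = iter_stage r D A G S"
proof -
  consider "S = {}" | m where "m \<in> S" "\<forall>x\<in>S. (x, m) \<in> r"
    | "S \<noteq> {}" "\<not> (\<exists>m\<in>S. \<forall>x\<in>S. (x, m) \<in> r)" by blast
  then show ?thesis
  proof cases
    case 1
    then show ?thesis by (simp add: iter_stage_def)
  next
    case 2
    then show ?thesis using assms by (simp add: iter_stage_greatest[of r m])
  next
    case 3
    then show ?thesis using assms by (simp add: iter_stage_limit)
  qed
qed

text \<open>Trades the recursor for its fixpoint equation, the only form in which the iterates are
  used afterwards.\<close>

lemma ord_iter_stages:
  assumes "Well_order r"
  obtains F where "\<And>x. F x = iter_stage r D A F (underS r x)"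
    and "ord_iter r D A = iter_stage r D A F (Field r)"
proof -
  have r: "wo_rel r" using assms by (simp add: wo_rel_def)
  let ?H = "\<lambda>F x. iter_stage r D A F (underS r x)"
  have "wo_rel.adm_wo r ?H"
    unfolding wo_rel.adm_wo_def[OF r]
    by (auto intro!: iter_stage_cong wo_rel.ANTISYM[OF r])
  then have "wo_rel.worec r ?H = ?H (wo_rel.worec r ?H)" by (rule wo_rel.worec_fixpoint[OF r])
  then show thesis
    by (intro that[of "wo_rel.worec r ?H"]) (simp_all only: ord_iter_def fun_eq_iff)
qed

text \<open>The segment below \<open>Suc n\<close> has greatest element \<open>n\<close>, while the
  whole field has none, so the final stage is a limit.\<close>

lemma ord_iter_natLeq: "ord_iter natLeq D A = (\<Inter>n. (D ^^ n) A)"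
proof -
  obtain F where F: "\<And>x. F x = iter_stage natLeq D A F (underS natLeq x)"
    "ord_iter natLeq D A = iter_stage natLeq D A F (Field natLeq)"
    using ord_iter_stages[OF natLeq_Well_order] by blast
  have "F n = (D ^^ n) A" for n
  proof (induction n)
    case 0
    have "underS natLeq (0 :: nat) = {}" by (simp add: natLeq_underS_less)
    then show ?case using F(1)[of 0] by (simp add: iter_stage_def)
  next
    case (Suc n)
    have "underS natLeq (Suc n) = {..<Suc n}" by (auto simp: natLeq_underS_less)
    then have "F (Suc n) = iter_stage natLeq D A F {..<Suc n}" using F(1)[of "Suc n"] by simp
    also have "\<dots> = D (F n)"
      by (rule iter_stage_greatest[OF natLeq_antisym]) (auto simp: natLeq_def)
    finally have "F (Suc n) = D (F n)" .
    with Suc show ?case by simp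
  qed
  moreover have "\<not> (\<exists>m\<in>UNIV. \<forall>x\<in>UNIV. (x, m) \<in> natLeq)"
    by (auto simp: natLeq_def) (meson Suc_n_not_le_n)
  ultimately show ?thesis
    by (simp add: F(2) Field_natLeq iter_stage_limit)
qed

section \<open>Ordinal products and iteration in blocks of length omega\<close>

lemma Field_ord_prod:
  assumes "Refl r" "Refl s"
  shows "Field (ord_prod r s) = Field r \<times> Field s"
proof
  show "Field (ord_prod r s) \<subseteq> Field r \<times> Field s"
    unfolding Field_def[of "ord_prod r s"] by (auto simp: ord_prod_def)
  have "(p, p) \<in> ord_prod r s" if "p \<in> Field r \<times> Field s" for p
    using that assms by (auto simp: ord_prod_def refl_on_def)
  then show "Field r \<times> Field s \<subseteq> Field (ord_prod r s)"
    by (blast intro: FieldI1)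
qed

lemma Well_order_ord_prod:
  assumes r: "Well_order r" and s: "Well_order s"
  shows "Well_order (ord_prod r s)"
proof -
  interpret r: wo_rel r using r by (simp add: wo_rel_def)
  interpret s: wo_rel s using s by (simp add: wo_rel_def)
  have F: "Field (ord_prod r s) = Field r \<times> Field s"
    using r.REFL s.REFL by (rule Field_ord_prod)
  have "ord_prod r s \<subseteq> Field (ord_prod r s) \<times> Field (ord_prod r s)"
    by (auto simp: Field_def)
  moreover have "Refl (ord_prod r s)"
    unfolding F using r.REFL by (auto simp: refl_on_def ord_prod_def)
  moreover have "trans (ord_prod r s)"
    using r.TRANS s.TRANS s.ANTISYM
    by (auto simp: trans_def antisym_def ord_prod_def; blast)
  moreover have "antisym (ord_prod r s)"
    using r.ANTISYM s.ANTISYM by (auto simp: antisym_def ord_prod_def)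
  moreover have "Total (ord_prod r s)"
    unfolding F using r.TOTAL s.TOTAL by (auto simp: total_on_def ord_prod_def)
  moreover have "wf (ord_prod r s - Id)"
  proof (rule wf_subset)
    \<comment> \<open>After swapping the components, the product order is lexicographic with the
      component from \<open>s\<close> leading.\<close>
    show "wf (inv_image ((s - Id) <*lex*> (r - Id)) prod.swap)"
      using r.WF s.WF by (intro wf_inv_image wf_lex_prod)
    show "ord_prod r s - Id \<subseteq> inv_image ((s - Id) <*lex*> (r - Id)) prod.swap"
      by (auto simp: ord_prod_def)
  qed
  ultimately show ?thesis
    by (simp add: well_order_on_def linear_order_on_def partial_order_on_def preorder_on_def)
qed

text \<open>The index of \<open>(n, y)\<close> is omega times the index of \<open>y\<close>, plus
  \<open>n\<close>: complete blocks below \<open>y\<close> come first, then \<open>n\<close> points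
  of the block of \<open>y\<close>.\<close>

lemma underS_ord_prod_natLeq:
  assumes "y \<in> Field \<alpha>"
  shows "underS (ord_prod natLeq \<alpha>) (n, y) = UNIV \<times> underS \<alpha> y \<union> {..<n} \<times> {y}"
  using assms by (auto simp: underS_def ord_prod_def Field_natLeq natLeq_def Field_def)

text \<open>One step of \<open>D'\<close> is paid for by a whole block of omega steps of
  \<open>D\<close>, by transfinite induction over the blocks. The predicate \<open>Q\<close> is an
  invariant class of sets to which monotonicity and the one-block comparison are confined.\<close>

lemma ord_iter_prod_natLeq_subset:
  assumes \<alpha>: "Well_order \<alpha>" and A: "Q A"
    and Q: "\<And>B. Q B \<Longrightarrow> Q (D B)" "\<And>B. Q B \<Longrightarrow> Q (D' B)"
      "\<And>\<S>. \<S> \<noteq> {} \<Longrightarrow> \<forall>B\<in>\<S>. Q B \<Longrightarrow> Q (\<Inter>\<S>)"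
    and mono: "\<And>B B'. B \<subseteq> B' \<Longrightarrow> Q B \<Longrightarrow> Q B' \<Longrightarrow> D B \<subseteq> D B'"
    and omega: "\<And>B. Q B \<Longrightarrow> (\<Inter>n. (D ^^ n) B) \<subseteq> D' B"
  shows "ord_iter (ord_prod natLeq \<alpha>) D A \<subseteq> ord_iter \<alpha> D' A"
proof -
  let ?P = "ord_prod natLeq \<alpha>"
  interpret \<alpha>: wo_rel \<alpha> using \<alpha> by (simp add: wo_rel_def)
  have P: "Well_order ?P" by (intro Well_order_ord_prod natLeq_Well_order \<alpha>)
  interpret P: wo_rel ?P using P by (simp add: wo_rel_def)
  obtain G where G: "\<And>x. G x = iter_stage ?P D A G (underS ?P x)"
    "ord_iter ?P D A = iter_stage ?P D A G (Field ?P)"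
    using ord_iter_stages[OF P] by blast
  obtain F where F: "\<And>x. F x = iter_stage \<alpha> D' A F (underS \<alpha> x)"
    "ord_iter \<alpha> D' A = iter_stage \<alpha> D' A F (Field \<alpha>)"
    using ord_iter_stages[OF \<alpha>] by blast
  \<comment> \<open>Inside the block of \<open>y\<close>, which starts below \<open>F y\<close>,
    monotonicity preserves the inclusion through \<open>n\<close> steps of \<open>D\<close>.\<close>
  define good where "good y \<longleftrightarrow> Q (F y) \<and> (\<forall>n. Q (G (n, y)) \<and> G (n, y) \<subseteq> (D ^^ n) (F y))" for y
  have Q_funpow: "Q ((D ^^ n) B)" if "Q B" for n B
    using that by (induction n) (auto intro: Q(1))
  \<comment> \<open>Stated for arbitrary \<open>S\<close> so that it serves both for
    \<open>underS \<alpha> y\<close> and for the whole field.\<close>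
  have stage: "Q (iter_stage ?P D A G (UNIV \<times> S)) \<and> Q (iter_stage \<alpha> D' A F S) \<and>
      iter_stage ?P D A G (UNIV \<times> S) \<subseteq> iter_stage \<alpha> D' A F S"
    if S: "S \<subseteq> Field \<alpha>" "\<And>y. y \<in> S \<Longrightarrow> good y" for S
  proof (cases "S = {}")
    case True
    then show ?thesis using A by (simp add: iter_stage_def)
  next
    case False
    \<comment> \<open>Blocks have no last point, so the product side is at a limit even where
      \<open>\<alpha>\<close> is at a successor.\<close>
    have "\<not> (\<exists>m\<in>UNIV \<times> S. \<forall>x\<in>UNIV \<times> S. (x, m) \<in> ?P)"
    proof
      assume "\<exists>m\<in>UNIV \<times> S. \<forall>x\<in>UNIV \<times> S. (x, m) \<in> ?P"
      then obtain n y where "y \<in> S" "\<forall>x\<in>UNIV \<times> S. (x, (n, y)) \<in> ?P" by auto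
      then have "((Suc n, y), (n, y)) \<in> ?P" by auto
      then show False by (simp add: ord_prod_def natLeq_def)
    qed
    then have X: "iter_stage ?P D A G (UNIV \<times> S) = (\<Inter>x\<in>UNIV \<times> S. G x)"
      using False by (intro iter_stage_limit) auto
    have QX: "Q (\<Inter>x\<in>UNIV \<times> S. G x)"
      using False S(2) by (intro Q(3)) (auto simp: good_def)
    show ?thesis
    proof (cases "\<exists>m\<in>S. \<forall>x\<in>S. (x, m) \<in> \<alpha>")
      case True
      then obtain m where m: "m \<in> S" "\<And>x. x \<in> S \<Longrightarrow> (x, m) \<in> \<alpha>" by blast
      have Y: "iter_stage \<alpha> D' A F S = D' (F m)"
        using m by (rule iter_stage_greatest[OF \<alpha>.ANTISYM])
      \<comment> \<open>The block of \<open>m\<close> alone already provides all finite iterates of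
        \<open>D\<close> on \<open>F m\<close>.\<close>
      have "(\<Inter>x\<in>UNIV \<times> S. G x) \<subseteq> (\<Inter>n. (D ^^ n) (F m))"
        using S(2)[OF m(1)] m(1) unfolding good_def by blast
      also have "\<dots> \<subseteq> D' (F m)" using S(2)[OF m(1)] by (intro omega) (simp add: good_def)
      finally show ?thesis
        using QX S(2)[OF m(1)] Q(2) by (simp add: X Y good_def)
    next
      case no_max: False
      have Y: "iter_stage \<alpha> D' A F S = (\<Inter>y\<in>S. F y)"
        using False no_max by (rule iter_stage_limit)
      have "G (0, y) \<subseteq> F y" if "y \<in> S" for y
        using S(2)[OF that] unfolding good_def by (metis funpow_0)
      then have "(\<Inter>x\<in>UNIV \<times> S. G x) \<subseteq> (\<Inter>y\<in>S. F y)" by blast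
      moreover have "Q (\<Inter>y\<in>S. F y)"
        using False S(2) by (intro Q(3)) (auto simp: good_def)
      ultimately show ?thesis using QX by (simp add: X Y)
    qed
  qed
  have "y \<in> Field \<alpha> \<longrightarrow> good y" for y
  proof (induction y rule: wf_induct_rule[OF \<alpha>.WF])
    case (1 y)
    show ?case
    proof
      assume y: "y \<in> Field \<alpha>"
      have S: "underS \<alpha> y \<subseteq> Field \<alpha>" "\<And>y'. y' \<in> underS \<alpha> y \<Longrightarrow> good y'"
        using 1 by (auto simp: underS_def Field_def)
      note under = underS_ord_prod_natLeq[OF y]
      have FQ: "Q (F y)" and G0: "Q (G (0, y))" "G (0, y) \<subseteq> F y"
        using stage[OF S] F(1)[of y] G(1)[of "(0, y)"] by (simp_all add: under)
      have "Q (G (n, y)) \<and> G (n, y) \<subseteq> (D ^^ n) (F y)" for n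
      proof (induction n)
        case 0
        then show ?case using G0 by simp
      next
        case (Suc n)
        have "G (Suc n, y) = D (G (n, y))"
          unfolding G(1)[of "(Suc n, y)"] under
        proof (rule iter_stage_greatest[OF P.ANTISYM])
          fix x assume "x \<in> UNIV \<times> underS \<alpha> y \<union> {..<Suc n} \<times> {y}"
          then show "(x, (n, y)) \<in> ?P"
            using y by (auto simp: ord_prod_def underS_def Field_natLeq natLeq_def Field_def)
        qed simp
        then show ?case
          using Suc mono Q(1) Q_funpow[OF FQ] by simp
      qed
      with FQ show "good y" by (simp add: good_def)
    qed
  qed
  then have "iter_stage ?P D A G (UNIV \<times> Field \<alpha>) \<subseteq> iter_stage \<alpha> D' A F (Field \<alpha>)"
    using stage[of "Field \<alpha>"] by blast
  moreover have "Field ?P = UNIV \<times> Field \<alpha>"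
    using Field_ord_prod[OF natLeq_Refl \<alpha>.REFL] by (simp add: Field_natLeq)
  ultimately show ?thesis by (simp add: F(2) G(2))
qed

section \<open>Weak* compactness and separation\<close>

text \<open>Evaluations separate functionals. The purpose is that weak*-compact sets become
  weak*-closed.\<close>

lemma Hausdorff_space_weak_star: "Hausdorff_space weak_star"
proof -
  have "\<exists>U V. openin weak_star U \<and> openin weak_star V \<and> f \<in> U \<and> g \<in> V \<and> disjnt U V"
    if "f \<noteq> g" for f g :: "'a \<Rightarrow>\<^sub>L real"
  proof -
    have "blinfun_apply f \<noteq> blinfun_apply g"
      using that by (simp add: blinfun_apply_inject)
    then obtain x where "blinfun_apply f x \<noteq> blinfun_apply g x"
      by (auto simp: fun_eq_iff)
    then obtain U V where UV: "open U" "open V" "blinfun_apply f x \<in> U" "blinfun_apply g x \<in> V" "U \<inter> V = {}"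
      using hausdorff[of "blinfun_apply f x" "blinfun_apply g x"] by blast
    have "openin weak_star {h. blinfun_apply h x \<in> W}" if "open W" for W
      using openin_continuous_map_preimage[OF strong_operator_topology_continuous_evaluation, of W x] that
      by (simp add: strong_operator_topology_topspace)
    then show ?thesis
      using UV by (intro exI[of _ "{h. blinfun_apply h x \<in> U}"] exI[of _ "{h. blinfun_apply h x \<in> V}"])
        (auto simp: disjnt_def)
  qed
  then show ?thesis by (simp add: Hausdorff_space_def)
qed

text \<open>Scalars may vary with the point, which covers scalings, sums, segments and the
  parametrisation of convex hulls at once.\<close>

lemma continuous_map_weak_star_lincomb:
  assumes "continuous_map X euclideanreal a" "continuous_map X weak_star f"
    and "continuous_map X euclideanreal b" "continuous_map X weak_star g"
  shows "continuous_map X weak_star (\<lambda>p. a p *\<^sub>R f p + b p *\<^sub>R g p)"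
proof -
  have "continuous_map X euclideanreal (\<lambda>p. blinfun_apply (f p) x)"
       "continuous_map X euclideanreal (\<lambda>p. blinfun_apply (g p) x)" for x
    using assms by (simp_all add: continuous_on_strong_operator_topo_iff_coordinatewise)
  then show ?thesis
    using assms
    by (auto simp: continuous_on_strong_operator_topo_iff_coordinatewise blinfun.add_left
        blinfun.scaleR_left intro!: continuous_map_add continuous_map_real_mult)
qed

lemma compactin_weak_star_scaleR:
  assumes "compactin weak_star A"
  shows "compactin weak_star ((\<lambda>f. c *\<^sub>R f) ` A)"
proof (rule image_compactin[OF assms])
  show "continuous_map weak_star weak_star (\<lambda>f :: 'a \<Rightarrow>\<^sub>L real. c *\<^sub>R f)"
    using continuous_map_weak_star_lincomb[of weak_star "\<lambda>_. c" "\<lambda>f. f" "\<lambda>_. 0" "\<lambda>f. f"]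
    by simp
qed

lemma compactin_weak_star_set_plus:
  assumes "compactin weak_star A" "compactin weak_star B"
  shows "compactin weak_star (A + B)"
proof -
  have "continuous_map (prod_topology weak_star weak_star) weak_star
          (\<lambda>p :: ('a \<Rightarrow>\<^sub>L real) \<times> ('a \<Rightarrow>\<^sub>L real). fst p + snd p)"
    using continuous_map_weak_star_lincomb[of "prod_topology weak_star weak_star" "\<lambda>_. 1" fst "\<lambda>_. 1" snd]
    by (simp add: continuous_map_fst continuous_map_snd)
  moreover have "compactin (prod_topology weak_star weak_star) (A \<times> B)"
    using assms by (simp add: compactin_Times)
  ultimately have "compactin weak_star ((\<lambda>p. fst p + snd p) ` (A \<times> B))"
    by (rule image_compactin[rotated])
  moreover have "(\<lambda>p. fst p + snd p) ` (A \<times> B) = A + B"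
    by (force simp: set_plus_def)
  ultimately show ?thesis by simp
qed

section \<open>Weak* halfspaces and their closures\<close>

lemma closedin_weak_star_halfspaces:
  "closedin weak_star {f. t \<le> blinfun_apply f x}"
  "closedin weak_star {f. blinfun_apply f x \<le> t}"
  using closedin_continuous_map_preimage[OF strong_operator_topology_continuous_evaluation, of "{t..}" x]
    closedin_continuous_map_preimage[OF strong_operator_topology_continuous_evaluation, of "{..t}" x]
  by (simp_all add: strong_operator_topology_topspace)

lemma openin_weak_star_open_halfspace:
  assumes "weak_star_open_halfspace H"
  shows "openin weak_star H"
proof -
  obtain x t where H: "H = {f. blinfun_apply f x > t}"
    using assms by (auto simp: weak_star_open_halfspace_def)
  show ?thesis
    using openin_continuous_map_preimage[OF strong_operator_topology_continuous_evaluation, of "{t<..}" x]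
    by (simp add: strong_operator_topology_topspace H)
qed

text \<open>The nonemptiness hypothesis matters: without the Hahn--Banach theorem one cannot exclude that
  every functional vanishes at \<open>x\<close>.\<close>

lemma closure_of_weak_star_halfspace:
  fixes f :: "'a::real_normed_vector \<Rightarrow>\<^sub>L real"
  assumes "t < blinfun_apply f x"
  shows "weak_star closure_of {g. t < blinfun_apply g x} = {g. t \<le> blinfun_apply g x}"
proof
  show "weak_star closure_of {g. t < blinfun_apply g x} \<subseteq> {g. t \<le> blinfun_apply g x}"
    by (rule closure_of_minimal) (auto simp: closedin_weak_star_halfspaces)
  show "{g. t \<le> blinfun_apply g x} \<subseteq> weak_star closure_of {g. t < blinfun_apply g x}"
  proof
    fix h assume h: "h \<in> {g. t \<le> blinfun_apply g x}"
    have "\<exists>y. y \<in> {g. t < blinfun_apply g x} \<and> y \<in> V" if V: "h \<in> V" "openin weak_star V" for V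
    proof -
      \<comment> \<open>The segment from \<open>h\<close> to \<open>f\<close> enters the open
        halfspace at once and stays in \<open>V\<close> for small \<open>s\<close>.\<close>
      define p where "p s = (1 - s) *\<^sub>R h + s *\<^sub>R f" for s :: real
      have "continuous_map euclideanreal weak_star p"
        unfolding p_def
        by (intro continuous_map_weak_star_lincomb) (auto intro!: continuous_intros
              simp: strong_operator_topology_topspace)
      then have "openin euclideanreal {s \<in> topspace euclideanreal. p s \<in> V}"
        using V by (intro openin_continuous_map_preimage)
      then have "open {s. p s \<in> V}" by simp
      moreover have "p 0 \<in> V" using V by (simp add: p_def)
      ultimately obtain e where e: "e > 0" "\<And>s. dist s 0 < e \<Longrightarrow> p s \<in> V"
        unfolding open_dist by blast
      define s where "s = min 1 (e / 2)"
      have s: "0 < s" "s \<le> 1" "p s \<in> V"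
        using e by (auto simp: s_def dist_real_def)
      have "t < (1 - s) * blinfun_apply h x + s * blinfun_apply f x"
      proof -
        have "(1 - s) * t \<le> (1 - s) * blinfun_apply h x"
          using s h by (intro mult_left_mono) auto
        moreover have "s * t < s * blinfun_apply f x"
          using s assms by simp
        ultimately show ?thesis by (simp add: algebra_simps)
      qed
      then have "t < blinfun_apply (p s) x"
        by (simp add: p_def blinfun.add_left blinfun.scaleR_left)
      with s show ?thesis by blast
    qed
    then show "h \<in> weak_star closure_of {g. t < blinfun_apply g x}"
      by (auto simp: in_closure_of strong_operator_topology_topspace)
  qed
qed

section \<open>Basic neighbourhoods and separation of points from compact convex sets\<close>

lemma weak_star_basic_nhd:
  fixes f :: "'a::real_normed_vector \<Rightarrow>\<^sub>L real"
  assumes "openin weak_star V" "f \<in> V"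
  obtains F :: "'a set" and e :: real
  where "finite F" "e > 0" "{g. \<forall>x\<in>F. \<bar>blinfun_apply g x - blinfun_apply f x\<bar> < e} \<subseteq> V"
proof -
  obtain W where W: "open W" "V = blinfun_apply -` W"
    using assms(1) by (auto simp: strong_operator_topology_def openin_pullback_topology)
  then have "openin (product_topology (\<lambda>i::'a. euclideanreal) UNIV) W"
    by (simp add: open_fun_def)
  moreover have "blinfun_apply f \<in> W" using W assms(2) by auto
  ultimately obtain U where U: "finite {i. U i \<noteq> UNIV}" "\<And>i. open (U i)"
      "blinfun_apply f \<in> Pi\<^sub>E UNIV U" "Pi\<^sub>E UNIV U \<subseteq> W"
    unfolding openin_product_topology_alt by (auto simp del: PiE_UNIV_domain)
  define F where "F = {i. U i \<noteq> UNIV}"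
  have "\<forall>i. \<exists>d>0. \<forall>z. dist z (blinfun_apply f i) < d \<longrightarrow> z \<in> U i"
    using U(2,3) unfolding open_dist by (auto simp: PiE_iff)
  then obtain d where d: "\<And>i. d i > 0" "\<And>i z. dist z (blinfun_apply f i) < d i \<Longrightarrow> z \<in> U i"
    by metis
  \<comment> \<open>The inserted 1 keeps the minimum meaningful when \<open>F\<close> is
    empty.\<close>
  define e where "e = Min (insert 1 (d ` F))"
  have fin: "finite (insert 1 (d ` F))" using U(1) by (simp add: F_def)
  have "e > 0" using fin d(1) by (auto simp: e_def)
  moreover have "{g. \<forall>x\<in>F. \<bar>blinfun_apply g x - blinfun_apply f x\<bar> < e} \<subseteq> V"
  proof
    fix g assume g: "g \<in> {g. \<forall>x\<in>F. \<bar>blinfun_apply g x - blinfun_apply f x\<bar> < e}"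
    have "blinfun_apply g i \<in> U i" for i
    proof (cases "i \<in> F")
      case True
      then have "e \<le> d i" using fin by (auto simp: e_def)
      with True g show ?thesis by (intro d(2)) (auto simp: dist_real_def)
    next
      case False
      then show ?thesis by (auto simp: F_def)
    qed
    then have "blinfun_apply g \<in> W" using U(4) by (auto simp: PiE_iff)
    then show "g \<in> V" using W by auto
  qed
  ultimately show thesis using that U(1) F_def by blast
qed

text \<open>The separating point is the gradient, at its minimiser over \<open>K\<close>, of the squared distance to
  \<open>f\<close> measured on finitely many points; the hypothesis \<open>x0 \<noteq> 0\<close> is needed for empty \<open>K\<close>.\<close>

lemma weak_star_separation:
  fixes K :: "('a::real_normed_vector \<Rightarrow>\<^sub>L real) set" and x0 :: 'a
  assumes K: "convex K" "compactin weak_star K" and f: "f \<notin> K" and x0: "x0 \<noteq> 0"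
  obtains x t where "x \<noteq> 0" "t < blinfun_apply f x" "\<And>g. g \<in> K \<Longrightarrow> blinfun_apply g x < t"
proof (cases "K = {}")
  case True
  then show thesis using that[of x0 "blinfun_apply f x0 - 1"] x0 by auto
next
  case False
  have "closedin weak_star K"
    using compactin_imp_closedin[OF Hausdorff_space_weak_star K(2)] .
  then have "openin weak_star (UNIV - K)"
    using openin_closedin_eq strong_operator_topology_topspace by (metis closedin_def)
  then obtain F e where F: "finite F" "e > 0"
      "{g. \<forall>x\<in>F. \<bar>blinfun_apply g x - blinfun_apply f x\<bar> < e} \<subseteq> UNIV - K"
    using weak_star_basic_nhd[of "UNIV - K" f] f by auto
  define \<phi> where "\<phi> g = (\<Sum>x\<in>F. (blinfun_apply g x - blinfun_apply f x)^2)" for g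
  have "continuous_map weak_star euclideanreal \<phi>"
    unfolding \<phi>_def
    by (intro continuous_map_sum F(1) continuous_map_real_pow continuous_map_diff
        strong_operator_topology_continuous_evaluation) auto
  then have "compact (\<phi> ` K)"
    using image_compactin[OF K(2)] by fastforce
  then obtain h where h: "h \<in> K" "\<And>g. g \<in> K \<Longrightarrow> \<phi> h \<le> \<phi> g"
    using compact_attains_inf[of "\<phi> ` K"] False by auto
  \<comment> \<open>The derivative of \<open>\<phi>\<close> at \<open>h\<close> in direction
    \<open>k\<close> is \<open>-2\<close> times the value of \<open>k\<close> at this
    \<open>x\<close>.\<close>
  define x where "x = (\<Sum>y\<in>F. (blinfun_apply f y - blinfun_apply h y) *\<^sub>R y)"
  have ax: "blinfun_apply g x = (\<Sum>y\<in>F. (blinfun_apply f y - blinfun_apply h y) * blinfun_apply g y)" for g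
    by (simp add: x_def blinfun.sum_right blinfun.scaleR_right)
  have fh: "blinfun_apply f x - blinfun_apply h x = \<phi> h"
    by (simp add: ax \<phi>_def sum_subtractf[symmetric] algebra_simps power2_eq_square)
  have pos: "\<phi> h > 0"
  proof -
    have "h \<notin> {g. \<forall>x\<in>F. \<bar>blinfun_apply g x - blinfun_apply f x\<bar> < e}" using F(3) h(1) by auto
    then obtain y where y: "y \<in> F" "e \<le> \<bar>blinfun_apply h y - blinfun_apply f y\<bar>" by force
    then have "0 < (blinfun_apply h y - blinfun_apply f y)^2" using F(2) by auto
    then show ?thesis unfolding \<phi>_def using F(1) y(1) by (intro sum_pos2) auto
  qed
  have le: "blinfun_apply g x \<le> blinfun_apply h x" if g: "g \<in> K" for g
  proof (rule ccontr)
    assume gt: "\<not> blinfun_apply g x \<le> blinfun_apply h x"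
    define a where "a = blinfun_apply g x - blinfun_apply h x"
    define b where "b = (\<Sum>y\<in>F. (blinfun_apply g y - blinfun_apply h y)^2)"
    have a: "a > 0" using gt by (simp add: a_def)
    have b: "b \<ge> 0" by (simp add: b_def sum_nonneg)
    have quad: "\<phi> ((1 - s) *\<^sub>R h + s *\<^sub>R g) = \<phi> h - 2 * s * a + s^2 * b" for s
    proof -
      have "((1 - s) * p + s * q - w)^2 = (p - w)^2 - 2 * s * ((w - p) * q - (w - p) * p) + s^2 * (q - p)^2"
        for p q w :: real
        by (simp add: power2_eq_square algebra_simps)
      moreover have "a = (\<Sum>y\<in>F. (blinfun_apply f y - blinfun_apply h y) * blinfun_apply g y
          - (blinfun_apply f y - blinfun_apply h y) * blinfun_apply h y)"
        by (simp only: a_def ax sum_subtractf)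
      ultimately show ?thesis
        by (simp add: \<phi>_def b_def blinfun.add_left blinfun.scaleR_left
            sum_subtractf[symmetric] sum.distrib[symmetric] sum_distrib_left)
    qed
    \<comment> \<open>Small enough that the linear gain \<open>2 * s * a\<close> beats the quadratic
      loss \<open>s^2 * b\<close>; the \<open>+ 1\<close> covers \<open>b = 0\<close>.\<close>
    define s where "s = min 1 (a / (b + 1))"
    have s: "0 < s" "s \<le> 1" using a b by (auto simp: s_def)
    have "s * (b + 1) \<le> a"
      using b by (simp add: s_def min_def pos_le_divide_eq)
    then have "s * b < 2 * a" using s a b by (simp add: algebra_simps)
    then have "s * (s * b) < s * (2 * a)" using s by (intro mult_strict_left_mono) auto
    then have "\<phi> ((1 - s) *\<^sub>R h + s *\<^sub>R g) < \<phi> h"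
      unfolding quad by (simp add: power2_eq_square algebra_simps)
    moreover have "(1 - s) *\<^sub>R h + s *\<^sub>R g \<in> K"
      using K(1) h(1) g s by (intro convexD) auto
    ultimately show False using h(2) by fastforce
  qed
  show thesis
  proof (rule that[of x "blinfun_apply h x + \<phi> h / 2"])
    show "x \<noteq> 0" using fh pos by auto
    show "blinfun_apply h x + \<phi> h / 2 < blinfun_apply f x" using fh pos by simp
    show "blinfun_apply g x < blinfun_apply h x + \<phi> h / 2" if "g \<in> K" for g
      using le[OF that] pos by simp
  qed
qed

section \<open>Convex hulls of unions\<close>

text \<open>Keeping the total weight as a factor lets the case of vanishing weights be treated once
  and for all.\<close>

lemma convex_weighted_sum:
  fixes C :: "'v::real_vector set"
  assumes "convex C" "c \<in> C" "c' \<in> C" "0 \<le> p" "0 \<le> q"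
  shows "\<exists>c''\<in>C. p *\<^sub>R c + q *\<^sub>R c' = (p + q) *\<^sub>R c''"
proof (cases "p + q = 0")
  case True
  then have "p = 0" "q = 0" using assms by auto
  then show ?thesis using assms by auto
next
  case False
  let ?c = "(p / (p + q)) *\<^sub>R c + (q / (p + q)) *\<^sub>R c'"
  have "?c \<in> C"
    using assms False by (intro convexD) (auto simp: add_divide_distrib[symmetric])
  moreover have "p *\<^sub>R c + q *\<^sub>R c' = (p + q) *\<^sub>R ?c"
    using False by (simp add: scaleR_add_right)
  ultimately show ?thesis by blast
qed

text \<open>The \<open>C\<close>-parts and the \<open>D\<close>-parts of a combination each regroup
  into one point, so the segments from \<open>C\<close> to \<open>D\<close> already form a convex
  set.\<close>

lemma convex_hull_Un:
  fixes C D :: "'v::real_vector set"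
  assumes C: "convex C" "C \<noteq> {}" and D: "convex D" "D \<noteq> {}"
  shows "convex hull (C \<union> D) = (\<lambda>(s, c, d). (1 - s) *\<^sub>R c + s *\<^sub>R d) ` ({0..1} \<times> C \<times> D)"
    (is "_ = ?J")
proof
  have J: "(1 - s) *\<^sub>R c + s *\<^sub>R d \<in> ?J" if "0 \<le> s" "s \<le> 1" "c \<in> C" "d \<in> D" for s c d
    using that by (intro image_eqI[of _ _ "(s, c, d)"]) auto
  have "convex ?J"
    unfolding convex_def
  proof (intro ballI allI impI, clarify)
    fix s s' u v :: real and c c' d d'
    assume s: "s \<in> {0..1}" "s' \<in> {0..1}" and c: "c \<in> C" "c' \<in> C" and d: "d \<in> D" "d' \<in> D"
      and u: "0 \<le> u" "0 \<le> v" "u + v = 1"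
    obtain c'' where c'': "c'' \<in> C" "(u * (1 - s)) *\<^sub>R c + (v * (1 - s')) *\<^sub>R c' = (u * (1 - s) + v * (1 - s')) *\<^sub>R c''"
      using convex_weighted_sum[OF C(1) c, of "u * (1 - s)" "v * (1 - s')"] s u by auto
    obtain d'' where d'': "d'' \<in> D" "(u * s) *\<^sub>R d + (v * s') *\<^sub>R d' = (u * s + v * s') *\<^sub>R d''"
      using convex_weighted_sum[OF D(1) d, of "u * s" "v * s'"] s u by auto
    let ?s = "u * s + v * s'"
    have "u * (1 - s) + v * (1 - s') = 1 - ?s" using u(3) by (simp add: algebra_simps)
    then have eq: "u *\<^sub>R ((1 - s) *\<^sub>R c + s *\<^sub>R d) + v *\<^sub>R ((1 - s') *\<^sub>R c' + s' *\<^sub>R d')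
        = (1 - ?s) *\<^sub>R c'' + ?s *\<^sub>R d''"
      using c''(2) d''(2) by (simp add: scaleR_add_right algebra_simps)
    have "?s \<ge> 0" using s u by auto
    moreover have "?s \<le> 1" using s u by (intro convex_bound_le) auto
    ultimately show "u *\<^sub>R ((1 - s) *\<^sub>R c + s *\<^sub>R d) + v *\<^sub>R ((1 - s') *\<^sub>R c' + s' *\<^sub>R d') \<in> ?J"
      unfolding eq using c''(1) d''(1) by (intro J)
  qed
  moreover have "C \<union> D \<subseteq> ?J"
  proof
    fix z assume z: "z \<in> C \<union> D"
    obtain c d where "c \<in> C" "d \<in> D" using C D by blast
    then have "z = (1 - 0) *\<^sub>R z + 0 *\<^sub>R d" "z = (1 - 1) *\<^sub>R c + 1 *\<^sub>R z" by simp_all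
    with \<open>c \<in> C\<close> \<open>d \<in> D\<close> z show "z \<in> ?J" using J[of 0 z d] J[of 1 c z] by (elim UnE) simp_all
  qed
  ultimately show "convex hull (C \<union> D) \<subseteq> ?J" by (rule hull_minimal[rotated])
  show "?J \<subseteq> convex hull (C \<union> D)"
  proof clarify
    fix s :: real and c d assume "s \<in> {0..1}" "c \<in> C" "d \<in> D"
    then show "(1 - s) *\<^sub>R c + s *\<^sub>R d \<in> convex hull (C \<union> D)"
      by (intro convexD[OF convex_convex_hull] hull_inc) simp_all
  qed
qed

text \<open>The hull is a continuous image of the compact product of \<open>{0..1}\<close>,
  \<open>C\<close> and \<open>D\<close>.\<close>

lemma compactin_weak_star_convex_hull_Un:
  assumes C: "convex C" "compactin weak_star C" and D: "convex D" "compactin weak_star D"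
  shows "compactin weak_star (convex hull (C \<union> D))"
proof (cases "C = {} \<or> D = {}")
  case True
  then show ?thesis using assms by (auto simp: convex_hull_eq[THEN iffD2])
next
  case False
  let ?X = "prod_topology euclideanreal (prod_topology weak_star weak_star)"
  have "continuous_map ?X weak_star (\<lambda>p. (1 - fst p) *\<^sub>R fst (snd p) + fst p *\<^sub>R snd (snd p))"
  proof (rule continuous_map_weak_star_lincomb)
    show "continuous_map ?X euclideanreal (\<lambda>p. 1 - fst p)"
      by (intro continuous_map_diff continuous_map_fst) simp
    show "continuous_map ?X weak_star (\<lambda>p. fst (snd p))" "continuous_map ?X weak_star (\<lambda>p. snd (snd p))"
      using continuous_map_compose[OF continuous_map_snd continuous_map_fst]
        continuous_map_compose[OF continuous_map_snd continuous_map_snd]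
      by (simp_all add: o_def)
  qed (rule continuous_map_fst)
  moreover have "compactin ?X ({0..1} \<times> C \<times> D)"
    using C D by (simp add: compactin_Times)
  ultimately have "compactin weak_star
      ((\<lambda>p. (1 - fst p) *\<^sub>R fst (snd p) + fst p *\<^sub>R snd (snd p)) ` ({0..1} \<times> C \<times> D))"
    by (rule image_compactin[rotated])
  then show ?thesis
    using False by (simp add: convex_hull_Un C(1) D(1) case_prod_unfold)
qed

section \<open>Slice derivations\<close>

definition wstar_convex_compact :: "('a::real_normed_vector \<Rightarrow>\<^sub>L real) set \<Rightarrow> bool" where
  "wstar_convex_compact B \<longleftrightarrow> convex B \<and> compactin weak_star B"

lemma convex_halfspaces_blinfun:
  fixes x :: "'a::real_normed_vector" and t :: real
  shows "convex {f. t \<le> blinfun_apply f x}" "convex {f. blinfun_apply f x \<le> t}"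
proof -
  have lin: "linear (\<lambda>f. blinfun_apply f x)"
    by (intro linearI) (auto simp: blinfun.add_left blinfun.scaleR_left)
  show "convex {f. t \<le> blinfun_apply f x}"
    using convex_linear_vimage[OF lin convex_real_interval(1)[of t]] by (simp add: vimage_def)
  show "convex {f. blinfun_apply f x \<le> t}"
    using convex_linear_vimage[OF lin convex_real_interval(2)[of t]] by (simp add: vimage_def)
qed

lemma wstar_convex_compact_Int_halfspace:
  assumes "wstar_convex_compact B"
  shows "wstar_convex_compact (B \<inter> {f. t \<le> blinfun_apply f x})"
    and "wstar_convex_compact (B \<inter> {f. blinfun_apply f x \<le> t})"
  using assms by (auto simp: wstar_convex_compact_def convex_Int convex_halfspaces_blinfun
      compact_Int_closedin closedin_weak_star_halfspaces)

lemma wstar_convex_compact_Inter: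
  assumes "\<S> \<noteq> {}" "\<forall>B\<in>\<S>. wstar_convex_compact B"
  shows "wstar_convex_compact (\<Inter>\<S>)"
proof -
  obtain B where "B \<in> \<S>" using assms(1) by blast
  then have "compactin weak_star (\<Inter>\<S>)"
    using assms(2) by (intro closed_compactin_Inter[of _ B])
      (auto simp: wstar_convex_compact_def intro: compactin_imp_closedin[OF Hausdorff_space_weak_star])
  then show ?thesis
    using assms(2) by (auto simp: wstar_convex_compact_def intro: convex_Inter)
qed

lemma slice_deriv_subset: "slice_deriv \<eta> \<epsilon> B \<subseteq> B"
  by (auto simp: slice_deriv_def)

text \<open>The point \<open>f\<close> witnesses that the open halfspace is nonempty, so its closure
  is the closed halfspace with the same threshold.\<close>

lemma not_in_slice_deriv:
  assumes "x \<noteq> 0" "t < blinfun_apply f x" "\<eta> (B \<inter> {g. t \<le> blinfun_apply g x}) < \<epsilon>"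
  shows "f \<notin> slice_deriv \<eta> \<epsilon> B"
proof
  assume "f \<in> slice_deriv \<eta> \<epsilon> B"
  moreover have "weak_star_open_halfspace {g. t < blinfun_apply g x}"
    using assms(1) by (auto simp: weak_star_open_halfspace_def)
  ultimately have "\<epsilon> \<le> \<eta> (B \<inter> weak_star closure_of {g. t < blinfun_apply g x})"
    using assms(2) by (auto simp: slice_deriv_def)
  then show False
    using assms(2,3) by (simp add: closure_of_weak_star_halfspace)
qed

lemma not_in_slice_derivE:
  assumes "f \<in> B" "f \<notin> slice_deriv \<eta> \<epsilon> B"
  obtains x t where "x \<noteq> 0" "t < blinfun_apply f x" "\<eta> (B \<inter> {g. t \<le> blinfun_apply g x}) < \<epsilon>"
proof -
  obtain H where H: "weak_star_open_halfspace H" "f \<in> H" "\<eta> (B \<inter> weak_star closure_of H) < \<epsilon>"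
    using assms by (auto simp: slice_deriv_def not_le)
  obtain x t where "x \<noteq> 0" "H = {g. t < blinfun_apply g x}"
    using H(1) by (auto simp: weak_star_open_halfspace_def)
  with H that[of x t] show thesis
    by (auto simp: closure_of_weak_star_halfspace)
qed

text \<open>Deriving removes open halfspaces, so an intersection of \<open>B\<close> with closed
  halfspaces remains. Inserting \<open>B\<close> keeps the family nonempty.\<close>

lemma wstar_convex_compact_slice_deriv:
  assumes "wstar_convex_compact B"
  shows "wstar_convex_compact (slice_deriv \<eta> \<epsilon> B)"
proof -
  let ?\<S> = "insert B {B \<inter> {f. blinfun_apply f x \<le> t} |x t.
     x \<noteq> 0 \<and> \<eta> (B \<inter> {g. t \<le> blinfun_apply g x}) < \<epsilon>}"
  have "slice_deriv \<eta> \<epsilon> B = \<Inter>?\<S>"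
  proof (intro equalityI subsetI)
    fix f assume f: "f \<in> slice_deriv \<eta> \<epsilon> B"
    then show "f \<in> \<Inter>?\<S>"
      using slice_deriv_subset[of \<eta> \<epsilon> B] not_in_slice_deriv[of _ _ f \<eta> B \<epsilon>]
      by (auto simp: not_less[symmetric])
  next
    fix f assume f: "f \<in> \<Inter>?\<S>"
    show "f \<in> slice_deriv \<eta> \<epsilon> B"
    proof (rule ccontr)
      assume "f \<notin> slice_deriv \<eta> \<epsilon> B"
      then obtain x t where "x \<noteq> 0" "t < blinfun_apply f x" "\<eta> (B \<inter> {g. t \<le> blinfun_apply g x}) < \<epsilon>"
        using f by (auto elim: not_in_slice_derivE)
      then have "f \<in> {f. blinfun_apply f x \<le> t}" using f by blast
      with \<open>t < blinfun_apply f x\<close> show False by simp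
    qed
  qed
  moreover have "wstar_convex_compact (\<Inter>?\<S>)"
    using assms wstar_convex_compact_Int_halfspace(2)[OF assms]
    by (intro wstar_convex_compact_Inter) blast+
  ultimately show ?thesis by simp
qed

lemma wstar_convex_compact_slice_deriv_funpow:
  assumes "wstar_convex_compact B"
  shows "wstar_convex_compact ((slice_deriv \<eta> \<epsilon> ^^ n) B)"
  using assms by (induction n) (auto intro: wstar_convex_compact_slice_deriv)

lemma decseq_slice_deriv_funpow: "decseq (\<lambda>n. (slice_deriv \<eta> \<epsilon> ^^ n) B)"
  using slice_deriv_subset by (intro decseq_SucI) auto

lemma slice_deriv_funpow_subset: "(slice_deriv \<eta> \<epsilon> ^^ n) B \<subseteq> B"
  using decseqD[OF decseq_slice_deriv_funpow, of 0 n] by simp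

section \<open>Measures of non-compactness\<close>

locale noncompactness =
  fixes \<eta> :: "('a::real_normed_vector \<Rightarrow>\<^sub>L real) set \<Rightarrow> real"
  assumes nm: "noncompactness_measure \<eta>"
begin

lemma nonneg: "compactin weak_star A \<Longrightarrow> 0 \<le> \<eta> A"
  using nm by (auto simp: noncompactness_measure_def)

lemma Un:
  assumes "compactin weak_star A" "compactin weak_star B"
  shows "\<eta> (A \<union> B) = max (\<eta> A) (\<eta> B)"
proof -
  have "\<forall>n (C :: nat \<Rightarrow> _). 1 \<le> n \<and> (\<forall>i\<in>{1..n}. compactin weak_star (C i)) \<longrightarrow>
        \<eta> (\<Union>i\<in>{1..n}. C i) = Max ((\<lambda>i. \<eta> (C i)) ` {1..n})"
    using nm by (auto simp: noncompactness_measure_def)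
  from this[rule_format, of 2 "\<lambda>i. if i = 1 then A else B"] assms
  have "\<eta> (\<Union>i\<in>{1..2::nat}. if i = 1 then A else B) = Max ((\<lambda>i. \<eta> (if i = 1 then A else B)) ` {1..2::nat})"
    by simp
  moreover have "{1..2::nat} = {1, 2}" by auto
  ultimately show ?thesis by simp
qed

lemma empty: "\<eta> {} = 0"
proof -
  have "\<eta> {0} = 0" using nm by (auto simp: noncompactness_measure_def)
  moreover have "compactin weak_star {0 :: 'a \<Rightarrow>\<^sub>L real}"
    by (simp add: strong_operator_topology_topspace)
  ultimately show ?thesis using Un[of "{}" "{0}"] nonneg[of "{}"] by simp
qed

lemma mono: "A \<subseteq> B \<Longrightarrow> compactin weak_star A \<Longrightarrow> compactin weak_star B \<Longrightarrow> \<eta> A \<le> \<eta> B"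
  using Un[of A B] by (simp add: Un_absorb1)

lemma finite_UN_less:
  assumes "finite F" "\<And>H. H \<in> F \<Longrightarrow> compactin weak_star (g H) \<and> \<eta> (g H) < \<delta>" "0 < \<delta>"
  shows "compactin weak_star (\<Union>H\<in>F. g H) \<and> \<eta> (\<Union>H\<in>F. g H) < \<delta>"
  using assms by (induction F rule: finite_induct) (auto simp: empty Un compactin_Un)

lemma slice_deriv_mono:
  assumes "B \<subseteq> B'" "compactin weak_star B" "compactin weak_star B'"
  shows "slice_deriv \<eta> \<epsilon> B \<subseteq> slice_deriv \<eta> \<epsilon> B'"
proof
  fix f assume f: "f \<in> slice_deriv \<eta> \<epsilon> B"
  have "\<eta> (B \<inter> weak_star closure_of H) \<le> \<eta> (B' \<inter> weak_star closure_of H)" for H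
    using assms by (intro mono compact_Int_closedin) auto
  with f assms(1) show "f \<in> slice_deriv \<eta> \<epsilon> B'"
    by (auto simp: slice_deriv_def intro: order_trans)
qed

lemma slice_deriv_funpow_mono:
  assumes "B \<subseteq> B'" "wstar_convex_compact B" "wstar_convex_compact B'"
  shows "(slice_deriv \<eta> \<epsilon> ^^ n) B \<subseteq> (slice_deriv \<eta> \<epsilon> ^^ n) B'"
proof (induction n)
  case (Suc n)
  have "compactin weak_star ((slice_deriv \<eta> \<epsilon> ^^ n) B)" "compactin weak_star ((slice_deriv \<eta> \<epsilon> ^^ n) B')"
    using assms(2,3) wstar_convex_compact_slice_deriv_funpow by (auto simp: wstar_convex_compact_def)
  with Suc show ?case by (simp add: slice_deriv_mono)
qed (use assms in simp)

text \<open>Finitely many halfspaces with small slices of \<open>C\<close> cover \<open>K\<close>,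
  and a finite union has the maximum as its measure, so the inequality stays strict. Positivity of
  \<open>\<delta>\<close> covers an empty subcover.\<close>

lemma measure_less_if_disjoint_slice_deriv:
  assumes "compactin weak_star C" "compactin weak_star K" "K \<subseteq> C" "K \<inter> slice_deriv \<eta> \<delta> C = {}" "0 < \<delta>"
  shows "\<eta> K < \<delta>"
proof -
  let ?\<U> = "{H. weak_star_open_halfspace H \<and> \<eta> (C \<inter> weak_star closure_of H) < \<delta>}"
  have "K \<subseteq> \<Union>?\<U>"
  proof
    fix f assume "f \<in> K"
    then have "f \<in> C" "f \<notin> slice_deriv \<eta> \<delta> C" using assms(3,4) by auto
    then show "f \<in> \<Union>?\<U>" by (auto simp: slice_deriv_def not_le)
  qed
  then obtain \<F> where F: "finite \<F>" "\<F> \<subseteq> ?\<U>" "K \<subseteq> \<Union>\<F>"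
    using compactinD[OF assms(2), of ?\<U>] openin_weak_star_open_halfspace by blast
  let ?V = "\<Union>H\<in>\<F>. C \<inter> weak_star closure_of H"
  have V: "compactin weak_star ?V \<and> \<eta> ?V < \<delta>"
    using F assms(1,5) by (intro finite_UN_less compact_Int_closedin conjI) auto
  have "K \<subseteq> ?V"
  proof
    fix f assume "f \<in> K"
    then obtain H where "H \<in> \<F>" "f \<in> H" using F(3) by blast
    moreover have "H \<subseteq> weak_star closure_of H"
      by (simp add: closure_of_subset strong_operator_topology_topspace)
    ultimately show "f \<in> ?V" using assms(3) \<open>f \<in> K\<close> by blast
  qed
  then have "\<eta> K \<le> \<eta> ?V" using mono V assms(2) by blast
  with V show ?thesis by linarith
qed

text \<open>A bound on \<open>Inf\<close> yields a member only of a nonempty set. With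
  \<open>\<delta> = \<eta> C + 1\<close> the whole space, as a neighbourhood, removes every point in
  one derivation.\<close>

lemma omega_measure_lessE:
  assumes "compactin weak_star C" "omega_measure \<eta> C < \<epsilon>"
  obtains \<delta> where "0 < \<delta>" "\<delta> < \<epsilon>" "ord_iter natLeq (fragment_deriv \<eta> \<delta>) C = {}"
proof -
  let ?E = "{\<epsilon>. 0 < \<epsilon> \<and> ord_iter natLeq (fragment_deriv \<eta> \<epsilon>) C = {}}"
  define \<delta> where "\<delta> = \<eta> C + 1"
  have "weak_star_nhd UNIV f" for f :: "'a \<Rightarrow>\<^sub>L real"
    using openin_topspace[of "weak_star :: ('a \<Rightarrow>\<^sub>L real) topology"]
    by (auto simp: weak_star_nhd_def strong_operator_topology_topspace)
  moreover have "weak_star closure_of UNIV = (UNIV :: ('a \<Rightarrow>\<^sub>L real) set)"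
    using closure_of_topspace[of "weak_star :: ('a \<Rightarrow>\<^sub>L real) topology"]
    by (simp add: strong_operator_topology_topspace)
  ultimately have "fragment_deriv \<eta> \<delta> C = {}"
    by (force simp: fragment_deriv_def \<delta>_def)
  then have "(fragment_deriv \<eta> \<delta> ^^ 1) C = {}" by simp
  then have "ord_iter natLeq (fragment_deriv \<eta> \<delta>) C = {}"
    unfolding ord_iter_natLeq by blast
  moreover have "0 < \<delta>" using nonneg[OF assms(1)] by (simp add: \<delta>_def)
  ultimately have "?E \<noteq> {}" by blast
  then show thesis
    using cInf_lessD[of ?E \<epsilon>] assms(2) that by (auto simp: omega_measure_def)
qed

end

text \<open>Cantor's intersection theorem for the decreasing closed subsets of the compact set
  \<open>B\<close>.\<close>

lemma slice_deriv_funpow_empty: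
  assumes "wstar_convex_compact B" "(\<Inter>n. (slice_deriv \<eta> \<epsilon> ^^ n) B) = {}"
  shows "\<exists>n. (slice_deriv \<eta> \<epsilon> ^^ n) B = {}"
proof (rule ccontr)
  assume ne: "\<nexists>n. (slice_deriv \<eta> \<epsilon> ^^ n) B = {}"
  have "(\<Inter>n. (slice_deriv \<eta> \<epsilon> ^^ n) B) \<noteq> {}"
  proof (rule compact_space_imp_nest[of "subtopology weak_star B"])
    show "compact_space (subtopology weak_star B)"
      using assms(1) by (auto simp: wstar_convex_compact_def compactin_subspace)
    show "closedin (subtopology weak_star B) ((slice_deriv \<eta> \<epsilon> ^^ n) B)" for n
      using wstar_convex_compact_slice_deriv_funpow[OF assms(1), of n \<eta> \<epsilon>]
      by (intro closedin_subset_topspace compactin_imp_closedin[OF Hausdorff_space_weak_star]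
          slice_deriv_funpow_subset) (auto simp: wstar_convex_compact_def)
  qed (use ne decseq_slice_deriv_funpow in auto)
  with assms(2) show False by simp
qed

section \<open>Slices of a slice against slices of the whole set\<close>

locale sublinear_noncompactness = noncompactness +
  assumes sublin: "sublinear_measure \<eta>"
begin

text \<open>A slice of the \<open>k\<close>-th derived set of \<open>B\<close> that misses the next hull consists of points
  \<open>c + s *\<^sub>R (d - c)\<close> with \<open>s \<le> r\<close> and \<open>c\<close> in a slice of the \<open>k\<close>-th derived set of the cap,
  because the thresholds \<open>M - r ^ k * (M - t)\<close> approach \<open>M\<close> geometrically.\<close>

lemma slice_deriv_funpow_subset_hull:
  fixes B :: "('a \<Rightarrow>\<^sub>L real) set" and x :: 'a and t M \<delta>0 \<delta> r :: real
  defines "cap k \<equiv> (slice_deriv \<eta> \<delta>0 ^^ k) (B \<inter> {f. t \<le> blinfun_apply f x})"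
    and "low u \<equiv> B \<inter> {f. blinfun_apply f x \<le> u}"
  assumes B: "wstar_convex_compact B" and x: "x \<noteq> 0"
    and M: "t \<le> M" "\<And>f. f \<in> B \<Longrightarrow> blinfun_apply f x \<le> M"
    and \<delta>: "0 < \<delta>0" "\<delta>0 < \<delta>"
    and r: "0 < r" "r \<le> 1" "r * \<eta> (B + (\<lambda>f. (- 1) *\<^sub>R f) ` B) \<le> \<delta> - \<delta>0"
  shows "(slice_deriv \<eta> \<delta> ^^ k) B \<subseteq> convex hull (cap k \<union> low (M - r ^ k * (M - t)))"
proof (induction k)
  case 0
  \<comment> \<open>For \<open>k = 0\<close> the threshold is \<open>t\<close> itself, and the two
    sides of \<open>t\<close> cover \<open>B\<close>.\<close>
  have "B \<subseteq> cap 0 \<union> low t" by (auto simp: cap_def low_def)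
  also have "\<dots> \<subseteq> convex hull (cap 0 \<union> low t)" by (rule hull_subset)
  finally show ?case by simp
next
  case (Suc k)
  define u where "u k = M - r ^ k * (M - t)" for k
  define Q where "Q k = convex hull (cap k \<union> low (u k))" for k
  have cap: "wstar_convex_compact (cap k)" for k
    unfolding cap_def using B
    by (intro wstar_convex_compact_slice_deriv_funpow wstar_convex_compact_Int_halfspace)
  have low: "wstar_convex_compact (low a)" for a
    unfolding low_def using B by (intro wstar_convex_compact_Int_halfspace)
  have capB: "cap k \<subseteq> B" for k
    unfolding cap_def using slice_deriv_funpow_subset by blast
  have lowB: "low a \<subseteq> B" for a by (auto simp: low_def)
  have Q: "convex (Q k)" "compactin weak_star (Q k)" for k
    using cap[of k] low[of "u k"]
    by (auto simp: Q_def wstar_convex_compact_def intro: compactin_weak_star_convex_hull_Un)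
  have u_mono: "u k \<le> u (Suc k)"
    using M(1) r by (simp add: u_def mult_left_le_one_le)
  show ?case
  proof
    fix f assume f: "f \<in> (slice_deriv \<eta> \<delta> ^^ Suc k) B"
    show "f \<in> convex hull (cap (Suc k) \<union> low (M - r ^ Suc k * (M - t)))"
    proof (rule ccontr)
      assume "\<not> ?thesis"
      then have "f \<notin> Q (Suc k)" by (simp add: Q_def u_def)
      \<comment> \<open>The vector \<open>x\<close> supplies the nonzero point that separation from
        a possibly empty hull asks for.\<close>
      then obtain y v where y: "y \<noteq> 0" "v < blinfun_apply f y" "\<And>g. g \<in> Q (Suc k) \<Longrightarrow> blinfun_apply g y < v"
        using weak_star_separation[OF Q _ x] by metis
      define G where "G = {g. v \<le> blinfun_apply g y}"
      have hull: "cap (Suc k) \<union> low (u (Suc k)) \<subseteq> Q (Suc k)"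
        unfolding Q_def by (rule hull_subset)
      let ?S = "cap k \<inter> G"
      let ?K = "B + (\<lambda>f. (- 1) *\<^sub>R f) ` B"
      have cS: "compactin weak_star ?S"
        using wstar_convex_compact_Int_halfspace(1)[OF cap] by (auto simp: G_def wstar_convex_compact_def)
      have "?S \<inter> slice_deriv \<eta> \<delta>0 (cap k) = {}"
      proof -
        have "slice_deriv \<eta> \<delta>0 (cap k) = cap (Suc k)" by (simp add: cap_def)
        then show ?thesis using hull y(3) by (force simp: G_def)
      qed
      then have S: "\<eta> ?S < \<delta>0"
        using cap[of k] cS \<delta>(1) by (intro measure_less_if_disjoint_slice_deriv) (auto simp: wstar_convex_compact_def)
      have cK: "compactin weak_star ?K"
        using B by (intro compactin_weak_star_set_plus compactin_weak_star_scaleR) (auto simp: wstar_convex_compact_def)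
      have crK: "compactin weak_star ((\<lambda>f. r *\<^sub>R f) ` ?K)"
        by (rule compactin_weak_star_scaleR[OF cK])
      have "(slice_deriv \<eta> \<delta> ^^ k) B \<inter> G \<subseteq> ?S + (\<lambda>f. r *\<^sub>R f) ` ?K"
      proof
        fix z assume z: "z \<in> (slice_deriv \<eta> \<delta> ^^ k) B \<inter> G"
        have zB: "z \<in> B" and zG: "v \<le> blinfun_apply z y" using z subsetD[OF slice_deriv_funpow_subset] by (auto simp: G_def)
        have zx: "u (Suc k) < blinfun_apply z x"
        proof (rule ccontr)
          assume "\<not> ?thesis"
          then have "z \<in> low (u (Suc k))" using zB by (simp add: low_def)
          then show False using hull y(3) zG by force
        qed
        have decomp: "z \<in> ?S + (\<lambda>f. r *\<^sub>R f) ` ?K" if c: "c \<in> cap k" "v \<le> blinfun_apply c y" and d: "d \<in> B"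
          and s: "0 \<le> s" "s \<le> r" "z = (1 - s) *\<^sub>R c + s *\<^sub>R d" for c d s
        proof -
          \<comment> \<open>Replaces the varying \<open>s\<close> by the fixed \<open>r\<close>:
            \<open>c + s (d - c) = c + r (e - c)\<close>, with \<open>e\<close> on the segment from
            \<open>c\<close> to \<open>d\<close> because \<open>s \<le> r\<close>.\<close>
          define e where "e = (1 - s / r) *\<^sub>R c + (s / r) *\<^sub>R d"
          have "e \<in> B"
            unfolding e_def using B c(1) capB d s r(1)
            by (intro convexD) (auto simp: wstar_convex_compact_def)
          moreover have "c \<in> ?S" "c \<in> B" using c capB by (auto simp: G_def)
          ultimately have "c + r *\<^sub>R (e + (- 1) *\<^sub>R c) \<in> ?S + (\<lambda>f. r *\<^sub>R f) ` ?K"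
            by (intro set_plus_intro imageI)
          moreover have "z = c + r *\<^sub>R (e + (- 1) *\<^sub>R c)"
            using r(1) s(3) by (simp add: e_def algebra_simps)
          ultimately show ?thesis by simp
        qed
        have "z \<in> Q k" using Suc.IH z by (auto simp: Q_def u_def)
        then consider "z \<in> cap k" | "z \<in> low (u k)"
          | s c d where "0 \<le> s" "s \<le> 1" "c \<in> cap k" "d \<in> low (u k)" "z = (1 - s) *\<^sub>R c + s *\<^sub>R d"
        proof (cases "cap k = {} \<or> low (u k) = {}")
          case True
          then show thesis
            using that(1,2) \<open>z \<in> Q k\<close> cap[of k] low[of "u k"]
            by (auto simp: Q_def wstar_convex_compact_def convex_hull_eq[THEN iffD2])
        next
          case False
          then have "z \<in> (\<lambda>(s, c, d). (1 - s) *\<^sub>R c + s *\<^sub>R d) ` ({0..1} \<times> cap k \<times> low (u k))"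
            using \<open>z \<in> Q k\<close> cap[of k] low[of "u k"]
            by (simp add: Q_def wstar_convex_compact_def convex_hull_Un)
          then obtain s c d where "z = (1 - s) *\<^sub>R c + s *\<^sub>R d" "s \<in> {0..1}" "c \<in> cap k" "d \<in> low (u k)"
            by auto
          then show thesis using that(3)[of s c d] by simp
        qed
        then show "z \<in> ?S + (\<lambda>f. r *\<^sub>R f) ` ?K"
        proof cases
          case 1
          then show ?thesis using decomp[of z z 0] zG zB r(1) by simp
        next
          case 2
          then show ?thesis using u_mono zx by (simp add: low_def)
        next
          case 3
          \<comment> \<open>The low part grows with the threshold, so \<open>d\<close> lies in the
            next hull and misses \<open>G\<close>; since \<open>z\<close> is in \<open>G\<close>,
            the point \<open>c\<close> must be too.\<close>
          have dy: "blinfun_apply d y < v"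
            using 3(4) u_mono hull by (intro y(3)) (auto simp: low_def)
          have cy: "v \<le> blinfun_apply c y"
          proof (rule ccontr)
            assume "\<not> ?thesis"
            then have "(1 - s) * blinfun_apply c y + s * blinfun_apply d y < v"
              using dy 3(1,2) by (intro convex_bound_lt) auto
            then show False using zG 3(5) by (simp add: blinfun.add_left blinfun.scaleR_left)
          qed
          \<comment> \<open>Comparing \<open>M - r * r ^ k * (M - t)\<close> with the bound
            \<open>M - s * r ^ k * (M - t)\<close> at \<open>z\<close> forces
            \<open>s < r\<close>.\<close>
          have "u (Suc k) < (1 - s) * blinfun_apply c x + s * blinfun_apply d x"
            using zx 3(5) by (simp add: blinfun.add_left blinfun.scaleR_left)
          also have "\<dots> \<le> (1 - s) * M + s * u k"
            using 3 capB M(2) by (intro add_mono mult_left_mono) (auto simp: low_def)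
          finally have "s * (r ^ k * (M - t)) < r * (r ^ k * (M - t))"
            by (simp add: u_def algebra_simps)
          then have "s < r"
            using M(1) r(1) by (elim mult_right_less_imp_less) simp
          then show ?thesis
            using decomp[of c d s] 3 cy lowB by auto
        qed
      qed
      moreover have "compactin weak_star ((slice_deriv \<eta> \<delta> ^^ k) B \<inter> G)"
        using wstar_convex_compact_Int_halfspace(1)[OF wstar_convex_compact_slice_deriv_funpow[OF B]]
        by (auto simp: G_def wstar_convex_compact_def)
      ultimately have "\<eta> ((slice_deriv \<eta> \<delta> ^^ k) B \<inter> G) \<le> \<eta> (?S + (\<lambda>f. r *\<^sub>R f) ` ?K)"
        using cS crK by (intro mono compactin_weak_star_set_plus)
      also have "\<dots> \<le> \<eta> ?S + \<eta> ((\<lambda>f. r *\<^sub>R f) ` ?K)"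
        using sublin cS crK by (simp add: sublinear_measure_def)
      also have "\<eta> ((\<lambda>f. r *\<^sub>R f) ` ?K) = r * \<eta> ?K"
        using sublin cK r(1) by (simp add: sublinear_measure_def)
      also have "\<eta> ?S + r * \<eta> ?K < \<delta>" using S r(3) by linarith
      finally have "f \<notin> slice_deriv \<eta> \<delta> ((slice_deriv \<eta> \<delta> ^^ k) B)"
        unfolding G_def by (rule not_in_slice_deriv[OF y(1,2)])
      with f show False by simp
    qed
  qed
qed

text \<open>Once the derived cap is empty, only the low part of the hull survives. Hence each round
  of \<open>n\<close> derivations multiplies the excess of the bound over \<open>t\<close> by
  \<open>1 - r ^ n\<close>, and the excess tends to 0.\<close>

lemma slice_deriv_funpow_omega_bound:
  fixes B :: "('a \<Rightarrow>\<^sub>L real) set" and x :: 'a and t \<delta>0 \<delta> :: real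
  assumes B: "wstar_convex_compact B" and x: "x \<noteq> 0" and \<delta>: "0 < \<delta>0" "\<delta>0 < \<delta>"
    and n: "(slice_deriv \<eta> \<delta>0 ^^ n) (B \<inter> {f. t \<le> blinfun_apply f x}) = {}"
    and f: "f \<in> (\<Inter>n. (slice_deriv \<eta> \<delta> ^^ n) B)"
  shows "blinfun_apply f x \<le> t"
proof -
  let ?D = "\<lambda>B. B + (\<lambda>f. (- 1) *\<^sub>R f) ` B"
  have cD: "compactin weak_star (?D B')" if "wstar_convex_compact B'" for B' :: "('a \<Rightarrow>\<^sub>L real) set"
    using that by (intro compactin_weak_star_set_plus compactin_weak_star_scaleR) (auto simp: wstar_convex_compact_def)
  \<comment> \<open>Makes the error from \<open>r (B - B)\<close> at most
    \<open>\<delta> - \<delta>0\<close>; the \<open>+ 1\<close> guards against a zero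
    denominator.\<close>
  define r where "r = min 1 ((\<delta> - \<delta>0) / (\<eta> (?D B) + 1))"
  have D0: "0 \<le> \<eta> (?D B)" using nonneg[OF cD[OF B]] .
  then have r: "0 < r" "r \<le> 1" using \<delta> by (auto simp: r_def)
  have "r * (\<eta> (?D B) + 1) \<le> \<delta> - \<delta>0"
    using D0 by (simp add: r_def min_def pos_le_divide_eq)
  then have rD: "r * \<eta> (?D B) \<le> \<delta> - \<delta>0" using r by (simp add: algebra_simps)
  \<comment> \<open>May be 0, namely for \<open>n = 0\<close> or \<open>r = 1\<close>; then the
    bound \<open>t\<close> is reached after one round.\<close>
  define q where "q = 1 - r ^ n"
  have "r ^ n \<le> 1" "0 < r ^ n" using r by (auto intro: power_le_one)
  then have q: "0 \<le> q" "q < 1" by (auto simp: q_def)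
  have "compact ((\<lambda>f. blinfun_apply f x) ` B)"
    using image_compactin[OF _ strong_operator_topology_continuous_evaluation, of B x] B
    by (auto simp: wstar_convex_compact_def)
  then have "bdd_above ((\<lambda>f. blinfun_apply f x) ` B)"
    by (intro bounded_imp_bdd_above compact_imp_bounded)
  then obtain M0 where M0: "\<And>g. g \<in> B \<Longrightarrow> blinfun_apply g x \<le> M0"
    by (auto simp: bdd_above_def)
  \<comment> \<open>The maximum ensures \<open>t \<le> M\<close> even if \<open>B\<close> lies below
    the threshold.\<close>
  define M where "M = max M0 t"
  have M: "t \<le> M" "\<And>g. g \<in> B \<Longrightarrow> blinfun_apply g x \<le> M"
    using M0 by (force simp: M_def)+
  have step: "g \<in> (slice_deriv \<eta> \<delta> ^^ (j * n)) B \<Longrightarrow> blinfun_apply g x \<le> t + q ^ j * (M - t)" for j g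
  proof (induction j arbitrary: g)
    case 0
    then show ?case using M by simp
  next
    case (Suc j)
    define B' where "B' = (slice_deriv \<eta> \<delta> ^^ (j * n)) B"
    define M' where "M' = t + q ^ j * (M - t)"
    have B': "wstar_convex_compact B'"
      unfolding B'_def by (rule wstar_convex_compact_slice_deriv_funpow[OF B])
    have sub: "B' \<subseteq> B"
      unfolding B'_def by (rule slice_deriv_funpow_subset)
    have "t \<le> M'" using q M by (simp add: M'_def)
    \<comment> \<open>Differences of points of \<open>B'\<close> are differences of points of
      \<open>B\<close>, so the same \<open>r\<close> works in every round.\<close>
    have "\<eta> (?D B') \<le> \<eta> (?D B)"
      using sub by (intro mono cD B B' set_plus_mono2) auto
    then have "r * \<eta> (?D B') \<le> \<delta> - \<delta>0"
      using r rD by (meson mult_left_mono less_imp_le order_trans)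
    then have "(slice_deriv \<eta> \<delta> ^^ n) B' \<subseteq> convex hull
        ((slice_deriv \<eta> \<delta>0 ^^ n) (B' \<inter> {f. t \<le> blinfun_apply f x}) \<union>
          B' \<inter> {f. blinfun_apply f x \<le> M' - r ^ n * (M' - t)})"
      using Suc.IH \<open>t \<le> M'\<close> r \<delta> by (intro slice_deriv_funpow_subset_hull B' x) (auto simp: B'_def M'_def)
    \<comment> \<open>By monotonicity the smaller cap dies out in the same \<open>n\<close>
      steps.\<close>
    moreover have "(slice_deriv \<eta> \<delta>0 ^^ n) (B' \<inter> {f. t \<le> blinfun_apply f x}) = {}"
      using slice_deriv_funpow_mono[of "B' \<inter> {f. t \<le> blinfun_apply f x}" "B \<inter> {f. t \<le> blinfun_apply f x}" n \<delta>0]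
        sub n wstar_convex_compact_Int_halfspace(1)[OF B] wstar_convex_compact_Int_halfspace(1)[OF B']
      by blast
    ultimately have "(slice_deriv \<eta> \<delta> ^^ n) B' \<subseteq> B' \<inter> {f. blinfun_apply f x \<le> M' - r ^ n * (M' - t)}"
      using wstar_convex_compact_Int_halfspace(2)[OF B']
      by (simp add: convex_hull_eq[THEN iffD2] wstar_convex_compact_def)
    moreover have "(slice_deriv \<eta> \<delta> ^^ (Suc j * n)) B = (slice_deriv \<eta> \<delta> ^^ n) B'"
      by (simp add: B'_def funpow_add)
    ultimately have "blinfun_apply g x \<le> M' - r ^ n * (M' - t)"
      using Suc.prems by auto
    also have "\<dots> = t + q ^ Suc j * (M - t)"
      by (simp add: M'_def q_def algebra_simps)
    finally show ?case .
  qed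
  have "(\<lambda>j. t + q ^ j * (M - t)) \<longlonglongrightarrow> t + 0 * (M - t)"
    using q by (intro tendsto_intros LIMSEQ_realpow_zero)
  then show ?thesis
    using LIMSEQ_le_const[of "\<lambda>j. t + q ^ j * (M - t)" t "blinfun_apply f x"] step f by auto
qed

end

section \<open>From a single slice to all ordinals\<close>

theorem proposition4p11:
  fixes \<eta> :: "('a::banach \<Rightarrow>\<^sub>L real) set \<Rightarrow> real"
    and \<theta> \<epsilon> \<mu> :: real
    and A :: "('a \<Rightarrow>\<^sub>L real) set"
    and \<alpha> :: "'i rel"
  assumes "noncompactness_measure \<eta>"
    and "sublinear_measure \<eta>"
    and "0 < \<theta>"
    and "\<And>B \<delta>. convex B \<Longrightarrow> compactin weak_star B \<Longrightarrow> 0 < \<delta> \<Longrightarrow>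
           ord_iter natLeq (fragment_deriv \<eta> \<delta>) B = {} \<Longrightarrow>
           ord_iter natLeq (slice_deriv \<eta> (\<theta> * \<delta>)) B = {}"
    and "convex A"
    and "compactin weak_star A"
    and "0 < \<epsilon>"
    and "\<theta> < \<mu>"
    and "Well_order \<alpha>"
  shows "ord_iter (ord_prod natLeq \<alpha>) (slice_deriv \<eta> (\<mu> * \<epsilon>)) A
           \<subseteq> ord_iter \<alpha> (slice_deriv (omega_measure \<eta>) \<epsilon>) A"
proof -
  interpret sublinear_noncompactness \<eta>
    using assms(1,2) by unfold_locales
  show ?thesis
  proof (rule ord_iter_prod_natLeq_subset[where Q = wstar_convex_compact])
    fix B assume B: "wstar_convex_compact (B :: ('a \<Rightarrow>\<^sub>L real) set)"
    show "(\<Inter>n. (slice_deriv \<eta> (\<mu> * \<epsilon>) ^^ n) B) \<subseteq> slice_deriv (omega_measure \<eta>) \<epsilon> B"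
    proof
      fix f assume f: "f \<in> (\<Inter>n. (slice_deriv \<eta> (\<mu> * \<epsilon>) ^^ n) B)"
      show "f \<in> slice_deriv (omega_measure \<eta>) \<epsilon> B"
      proof (rule ccontr)
        assume "\<not> ?thesis"
        moreover have "f \<in> B" using INT_D[OF f, of 0] by simp
        ultimately obtain x t where x: "x \<noteq> 0" "t < blinfun_apply f x"
            "omega_measure \<eta> (B \<inter> {g. t \<le> blinfun_apply g x}) < \<epsilon>"
          using not_in_slice_derivE by metis
        let ?C = "B \<inter> {g. t \<le> blinfun_apply g x}"
        have C: "wstar_convex_compact ?C" by (rule wstar_convex_compact_Int_halfspace[OF B])
        then obtain \<delta> where \<delta>: "0 < \<delta>" "\<delta> < \<epsilon>" "ord_iter natLeq (fragment_deriv \<eta> \<delta>) ?C = {}"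
          using omega_measure_lessE[OF _ x(3)] by (auto simp: wstar_convex_compact_def)
        then have "ord_iter natLeq (slice_deriv \<eta> (\<theta> * \<delta>)) ?C = {}"
          using C by (intro assms(4)) (auto simp: wstar_convex_compact_def)
        \<comment> \<open>Compactness turns extinction at stage omega into extinction at a finite
          stage.\<close>
        then obtain n where n: "(slice_deriv \<eta> (\<theta> * \<delta>) ^^ n) ?C = {}"
          unfolding ord_iter_natLeq using slice_deriv_funpow_empty[OF C] by blast
        \<comment> \<open>This strict gap is the room that the hull argument spends on
          \<open>r (B - B)\<close>.\<close>
        have "\<theta> * \<delta> < \<mu> * \<epsilon>"
          using \<delta> assms(3,8) by (intro mult_strict_mono) auto
        then have "blinfun_apply f x \<le> t"
          using \<delta>(1) assms(3) by (intro slice_deriv_funpow_omega_bound[OF B x(1) _ _ n f]) auto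
        with x(2) show False by simp
      qed
    qed
  next
    fix B B' :: "('a \<Rightarrow>\<^sub>L real) set"
    assume "B \<subseteq> B'" "wstar_convex_compact B" "wstar_convex_compact B'"
    then show "slice_deriv \<eta> (\<mu> * \<epsilon>) B \<subseteq> slice_deriv \<eta> (\<mu> * \<epsilon>) B'"
      by (simp add: slice_deriv_mono wstar_convex_compact_def)
  next
    show "wstar_convex_compact A" using assms by (simp add: wstar_convex_compact_def)
  qed (rule assms(9) wstar_convex_compact_slice_deriv wstar_convex_compact_Inter; assumption)+
qed

end
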